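(* If $G$ is a countable group which has a Cayley graph of infinite diameter (i.e., there is a generating set $S$ of $G$ such that the word length with respect to $S$ is unbounded on $G$), then $G$ is weakly amenable.
   Context: A countable group $G$ is weakly amenable if either $G$ is finite, or there is an equivalence relation $\sim$ on $G$ such that (1) $G/\!\sim$ is infinite, (2) for every $g\in G$ there is $b(g)\in\mathbb{N}$ such that for every class $C\in G/\!\sim$, $|\{C'\in G/\!\sim: gC\cap C'\neq\emptyset\}|\le b(g)$; and there is an increasing sequence of finite sets $A_n\subseteq G/\!\sim$ with $\bigcup_n A_n=G/\!\sim$ such that for every $g\in G$, $\lim_{n\to\infty}|\{C\in A_n: gC\subseteq \bigcup A_n\}|/|A_n|=1$, where $\bigcup A_n$ is the union of the classes in $A_n$. *)

theory Defs
  imports "HOL-Algebra.Generated_Groups" "HOL-Library.Countable_Set" Complex_Main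
begin

definition word_length :: "('a, 'b) monoid_scheme \<Rightarrow> 'a set \<Rightarrow> 'a \<Rightarrow> nat" where
  "word_length G S g =
     (LEAST n. \<exists>w. set w \<subseteq> S \<union> m_inv G ` S \<and> length w = n \<and>
        foldr (\<otimes>\<^bsub>G\<^esub>) w \<one>\<^bsub>G\<^esub> = g)"

text \<open>\<^const>\<open>word_length\<close> is the distance from the identity in the Cayley graph of \<open>G\<close> with
  respect to \<open>S\<close>. The value is meaningful only for elements of \<open>generate G S\<close>, hence the
  requirement that \<open>S\<close> generates \<open>G\<close>. The generating set \<open>S\<close> may be infinite.\<close>

definition has_infinite_diameter_Cayley_graph :: "('a, 'b) monoid_scheme \<Rightarrow> bool" where
  "has_infinite_diameter_Cayley_graph G \<longleftrightarrow>
     (\<exists>S. S \<subseteq> carrier G \<and> generate G S = carrier G \<and>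
        (\<forall>n. \<exists>g\<in>carrier G. n < word_length G S g))"

text \<open>The finiteness conjunct in the second condition is needed because \<^const>\<open>card\<close> is \<open>0\<close> on
  infinite sets.\<close>

definition weakly_amenable :: "('a, 'b) monoid_scheme \<Rightarrow> bool" where
  "weakly_amenable G \<longleftrightarrow>
     finite (carrier G) \<or>
     (\<exists>r. equiv (carrier G) r \<and>
        infinite (carrier G // r) \<and>
        (\<forall>g\<in>carrier G. \<exists>b::nat. \<forall>C\<in>carrier G // r.
           finite {C' \<in> carrier G // r. (g <#\<^bsub>G\<^esub> C) \<inter> C' \<noteq> {}} \<and>
           card {C' \<in> carrier G // r. (g <#\<^bsub>G\<^esub> C) \<inter> C' \<noteq> {}} \<le> b) \<and>
        (\<exists>A :: nat \<Rightarrow> 'a set set.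
           incseq A \<and>
           (\<forall>n. finite (A n)) \<and>
           (\<Union>n. A n) = carrier G // r \<and>
           (\<forall>g\<in>carrier G.
              (\<lambda>n. real (card {C \<in> A n. g <#\<^bsub>G\<^esub> C \<subseteq> \<Union> (A n)}) / real (card (A n)))
                \<longlonglongrightarrow> 1)))"

end

theory Submission
  imports Defs
begin

text \<open>The classes are the spheres of the Cayley graph. A suffix of a geodesic word is geodesic, so
  every radius occurs and the quotient is the set of natural numbers.
  Left multiplication by \<open>g\<close> moves the word length by at most a constant \<open>c\<close> depending only on \<open>g\<close>;
  hence it spreads a sphere over at most \<open>2 * c + 1\<close> spheres, and it moves at most \<open>c\<close> of the
  \<open>n + 1\<close> spheres of the ball of radius \<open>n\<close> out of that ball.\<close>

lemma tendsto_divide_1_if_bounded_diff: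
  fixes f g :: "'a \<Rightarrow> real"
  assumes bounded: "\<forall>\<^sub>F x in F. \<bar>f x - g x\<bar> \<le> c"
    and at_top: "filterlim g at_top F"
  shows "((\<lambda>x. f x / g x) \<longlongrightarrow> 1) F"
proof -
  have "((\<lambda>x. inverse (g x)) \<longlongrightarrow> 0) F"
    by (rule tendsto_inverse_0_at_top[OF at_top])
  moreover have "\<forall>\<^sub>F x in F. norm ((f x - g x) / g x) \<le> norm (inverse (g x)) * c"
    using bounded by eventually_elim (simp add: divide_simps)
  ultimately have "((\<lambda>x. (f x - g x) / g x) \<longlongrightarrow> 0) F"
    by (rule tendsto_0_le)
  then have "((\<lambda>x. 1 + (f x - g x) / g x) \<longlongrightarrow> 1 + 0) F"
    by (intro tendsto_add tendsto_const)
  moreover have "\<forall>\<^sub>F x in F. 1 + (f x - g x) / g x = f x / g x"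
    using filterlim_at_top_dense[THEN iffD1, OF at_top, rule_format, of 0]
    by eventually_elim (simp add: field_simps)
  ultimately show ?thesis
    using tendsto_cong by force
qed

definition level_set :: "'a set \<Rightarrow> ('a \<Rightarrow> 'b) \<Rightarrow> 'b \<Rightarrow> 'a set" where
  "level_set A f i = {x \<in> A. f x = i}"

lemma equiv_Restr_kernel: "equiv A (Restr (Equiv_Relations.kernel f) A)"
  by (rule equivI) (auto simp: Equiv_Relations.kernel_def refl_on_def sym_def trans_def)

lemma quotient_Restr_kernel_eq_image: "A // Restr (Equiv_Relations.kernel f) A = level_set A f ` f ` A"
proof -
  have "Restr (Equiv_Relations.kernel f) A `` {x} = level_set A f (f x)" if "x \<in> A" for x
    using that by (auto simp: Equiv_Relations.kernel_def level_set_def)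
  then show ?thesis
    by (auto simp: quotient_def)
qed

lemma inj_on_level_set: "inj_on (level_set A f) (f ` A)"
  by (rule inj_onI) (auto simp: level_set_def)

context monoid
begin

definition displacement_at_most :: "('a \<Rightarrow> nat) \<Rightarrow> 'a \<Rightarrow> nat \<Rightarrow> bool" where
  "displacement_at_most l g c \<longleftrightarrow>
     (\<forall>x\<in>carrier G. l (g \<otimes> x) \<le> l x + c \<and> l x \<le> l (g \<otimes> x) + c)"

lemma level_sets_meeting_l_coset_subset:
  assumes "displacement_at_most l g c"
  shows "{C \<in> range (level_set (carrier G) l). (g <# level_set (carrier G) l i) \<inter> C \<noteq> {}}
    \<subseteq> level_set (carrier G) l ` {i - c..i + c}"
proof
  fix C assume "C \<in> {C \<in> range (level_set (carrier G) l).
    (g <# level_set (carrier G) l i) \<inter> C \<noteq> {}}"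
  then obtain j x where C: "C = level_set (carrier G) l j"
    and x: "x \<in> carrier G" "l x = i" "l (g \<otimes> x) = j"
    by (auto simp: l_coset_def level_set_def)
  then have "j \<le> i + c" "i \<le> j + c"
    using assms by (auto simp: displacement_at_most_def)
  then show "C \<in> level_set (carrier G) l ` {i - c..i + c}"
    unfolding C by (intro imageI) simp
qed

lemma card_level_sets_meeting_l_coset:
  assumes "displacement_at_most l g c"
  defines "M \<equiv> \<lambda>i. {C \<in> range (level_set (carrier G) l).
    (g <# level_set (carrier G) l i) \<inter> C \<noteq> {}}"
  shows "finite (M i)" and "card (M i) \<le> 2 * c + 1"
proof -
  have subset: "M i \<subseteq> level_set (carrier G) l ` {i - c..i + c}"
    unfolding M_def by (rule level_sets_meeting_l_coset_subset[OF assms(1)])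
  then show "finite (M i)"
    by (rule finite_subset) simp
  have "card (M i) \<le> card {i - c..i + c}"
    using subset by (rule surj_card_le[OF finite_atLeastAtMost])
  also have "\<dots> \<le> 2 * c + 1"
    by simp
  finally show "card (M i) \<le> 2 * c + 1" .
qed

lemma l_coset_level_set_subset:
  assumes "displacement_at_most l g c" and "g \<in> carrier G" and "i + c \<le> n"
  shows "g <# level_set (carrier G) l i \<subseteq> \<Union> (level_set (carrier G) l ` {..n})"
proof
  fix y assume "y \<in> g <# level_set (carrier G) l i"
  then obtain x where x: "x \<in> carrier G" "l x = i" "y = g \<otimes> x"
    by (auto simp: l_coset_def level_set_def)
  then have "l y \<le> n"
    using assms(1,3) by (fastforce simp: displacement_at_most_def)
  then show "y \<in> \<Union> (level_set (carrier G) l ` {..n})"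
    using x assms(2) by (auto simp: level_set_def)
qed

lemma card_level_sets_staying_below:
  assumes displacement: "displacement_at_most l g c" and g: "g \<in> carrier G"
    and inj: "inj (level_set (carrier G) l)"
  defines "A \<equiv> \<lambda>n. level_set (carrier G) l ` {..n}"
  shows "card (A n) \<le> card {C \<in> A n. g <# C \<subseteq> \<Union> (A n)} + c"
proof -
  let ?good = "level_set (carrier G) l ` {..<n + 1 - c}"
  have "?good \<subseteq> {C \<in> A n. g <# C \<subseteq> \<Union> (A n)}"
  proof (clarify, intro conjI)
    fix i assume "i < n + 1 - c"
    then have "i + c \<le> n"
      by simp
    then show "level_set (carrier G) l i \<in> A n"
      and "g <# level_set (carrier G) l i \<subseteq> \<Union> (A n)"
      unfolding A_def using l_coset_level_set_subset[OF displacement g] by simp_all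
  qed
  then have "card ?good \<le> card {C \<in> A n. g <# C \<subseteq> \<Union> (A n)}"
    by (intro card_mono) (simp_all add: A_def)
  moreover have "card ?good = n + 1 - c" and "card (A n) = n + 1"
    using inj by (simp_all add: A_def card_image inj_on_subset)
  ultimately show ?thesis
    by simp
qed

lemma level_sets_Folner:
  assumes displacement: "displacement_at_most l g c" and g: "g \<in> carrier G"
    and inj: "inj (level_set (carrier G) l)"
  defines "A \<equiv> \<lambda>n. level_set (carrier G) l ` {..n}"
  shows "(\<lambda>n. real (card {C \<in> A n. g <# C \<subseteq> \<Union> (A n)}) / real (card (A n))) \<longlonglongrightarrow> 1"
proof (rule tendsto_divide_1_if_bounded_diff)
  show "\<forall>\<^sub>F n in sequentially.
      \<bar>real (card {C \<in> A n. g <# C \<subseteq> \<Union> (A n)}) - real (card (A n))\<bar> \<le> real c"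
  proof (intro always_eventually allI)
    fix n
    have "card {C \<in> A n. g <# C \<subseteq> \<Union> (A n)} \<le> card (A n)"
      by (rule card_mono) (auto simp: A_def)
    moreover have "card (A n) \<le> card {C \<in> A n. g <# C \<subseteq> \<Union> (A n)} + c"
      unfolding A_def by (rule card_level_sets_staying_below[OF displacement g inj])
    ultimately show "\<bar>real (card {C \<in> A n. g <# C \<subseteq> \<Union> (A n)}) - real (card (A n))\<bar> \<le> real c"
      by linarith
  qed
  have "card (A n) = Suc n" for n
    using inj by (simp add: A_def card_image inj_on_subset)
  then show "filterlim (\<lambda>n. real (card (A n))) at_top sequentially"
    using filterlim_compose[OF filterlim_real_sequentially filterlim_Suc] by simp
qed

theorem weakly_amenable_if_bounded_displacement:
  fixes l :: "'a \<Rightarrow> nat"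
  assumes displacement: "\<And>g. g \<in> carrier G \<Longrightarrow> \<exists>c. displacement_at_most l g c"
    and surj: "l ` carrier G = UNIV"
  shows "weakly_amenable G"
proof -
  let ?L = "level_set (carrier G) l" and ?r = "Restr (Equiv_Relations.kernel l) (carrier G)"
  define A where "A n = ?L ` {..n}" for n
  have quotient: "carrier G // ?r = range ?L"
    using quotient_Restr_kernel_eq_image[of "carrier G" l] by (simp add: surj)
  have inj: "inj ?L"
    using inj_on_level_set[of "carrier G" l] by (simp add: surj)
  have "infinite (range ?L)"
    using inj by (rule range_inj_infinite)
  moreover have "\<forall>g\<in>carrier G. \<exists>b. \<forall>C\<in>range ?L.
      finite {C' \<in> range ?L. (g <# C) \<inter> C' \<noteq> {}} \<and>
      card {C' \<in> range ?L. (g <# C) \<inter> C' \<noteq> {}} \<le> b"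
  proof (rule ballI)
    fix g assume "g \<in> carrier G"
    then obtain c where "displacement_at_most l g c"
      using displacement by blast
    then show "\<exists>b. \<forall>C\<in>range ?L.
        finite {C' \<in> range ?L. (g <# C) \<inter> C' \<noteq> {}} \<and>
        card {C' \<in> range ?L. (g <# C) \<inter> C' \<noteq> {}} \<le> b"
      using card_level_sets_meeting_l_coset by (intro exI[of _ "2 * c + 1"]) blast
  qed
  moreover have "incseq A" "\<forall>n. finite (A n)" "(\<Union>n. A n) = range ?L"
    by (auto simp: A_def incseq_def)
  moreover have "\<forall>g\<in>carrier G.
      (\<lambda>n. real (card {C \<in> A n. g <# C \<subseteq> \<Union> (A n)}) / real (card (A n))) \<longlonglongrightarrow> 1"
    unfolding A_def using displacement level_sets_Folner[OF _ _ inj] by blast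
  ultimately show ?thesis
    unfolding weakly_amenable_def
    by (intro disjI2 exI[of _ ?r] exI[of _ A] conjI) (simp_all add: equiv_Restr_kernel quotient)
qed

definition word_value :: "'a list \<Rightarrow> 'a" where
  "word_value w = foldr (\<otimes>) w \<one>"

lemma word_value_simps [simp]:
  "word_value [] = \<one>"
  "word_value (a # w) = a \<otimes> word_value w"
  by (simp_all add: word_value_def)

lemma word_value_closed:
  assumes "set w \<subseteq> carrier G"
  shows "word_value w \<in> carrier G"
  using assms by (induction w) simp_all

lemma word_value_append:
  assumes "set u \<subseteq> carrier G" and "set v \<subseteq> carrier G"
  shows "word_value (u @ v) = word_value u \<otimes> word_value v"
  using assms by (induction u) (simp_all add: m_assoc word_value_closed)

end

context group
begin

lemma displacement_at_most_if_subadditive: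
  fixes l :: "'a \<Rightarrow> nat"
  assumes subadd: "\<And>g h. g \<in> carrier G \<Longrightarrow> h \<in> carrier G \<Longrightarrow> l (g \<otimes> h) \<le> l g + l h"
    and g: "g \<in> carrier G"
  shows "displacement_at_most l g (max (l g) (l (inv g)))"
  unfolding displacement_at_most_def
proof
  fix x assume x: "x \<in> carrier G"
  have "x = inv g \<otimes> (g \<otimes> x)"
    using g x by (simp flip: m_assoc)
  then have "l x \<le> l (inv g) + l (g \<otimes> x)"
    using subadd[of "inv g" "g \<otimes> x"] g x by simp
  with subadd[OF g x]
  show "l (g \<otimes> x) \<le> l x + max (l g) (l (inv g)) \<and> l x \<le> l (g \<otimes> x) + max (l g) (l (inv g))"
    by linarith
qed

definition words :: "'a set \<Rightarrow> 'a list set" where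
  "words S = lists (S \<union> m_inv G ` S)"

lemma append_in_words_iff: "u @ v \<in> words S \<longleftrightarrow> u \<in> words S \<and> v \<in> words S"
  by (simp add: words_def)

lemma set_word_subset_carrier:
  assumes "S \<subseteq> carrier G" and "w \<in> words S"
  shows "set w \<subseteq> carrier G"
  using assms by (auto simp: words_def)

lemma generate_eq_word_value_image:
  assumes S: "S \<subseteq> carrier G"
  shows "generate G S = word_value ` words S"
proof (intro equalityI subsetI)
  fix g assume "g \<in> generate G S"
  then show "g \<in> word_value ` words S"
  proof induction
    case one
    show ?case by (rule image_eqI[of _ _ "[]"]) (simp_all add: words_def)
  next
    case (incl h)
    with S show ?case by (intro image_eqI[of _ _ "[h]"]) (auto simp: words_def)
  next
    case (inv h)
    with S show ?case by (intro image_eqI[of _ _ "[inv h]"]) (auto simp: words_def)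
  next
    case (eng g h)
    then obtain u v where "u \<in> words S" "g = word_value u" "v \<in> words S" "h = word_value v"
      by blast
    then show ?case
      using set_word_subset_carrier[OF S]
      by (intro image_eqI[of _ _ "u @ v"]) (simp_all add: append_in_words_iff word_value_append)
  qed
next
  fix g assume "g \<in> word_value ` words S"
  then obtain w where "set w \<subseteq> S \<union> m_inv G ` S" and "g = word_value w"
    by (auto simp: words_def)
  then show "g \<in> generate G S"
    by (induction w arbitrary: g) (auto intro: generate.intros)
qed

lemma word_length_eq_Least:
  "word_length G S g = (LEAST n. \<exists>w\<in>words S. length w = n \<and> word_value w = g)"
  by (simp add: word_length_def words_def word_value_def lists_eq_set Bex_def)

lemma word_length_word_value_le:
  assumes "w \<in> words S"
  shows "word_length G S (word_value w) \<le> length w"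
  unfolding word_length_eq_Least using assms by (intro Least_le) blast

lemma geodesic_wordE:
  assumes "S \<subseteq> carrier G" and "g \<in> generate G S"
  obtains w where "w \<in> words S" "word_value w = g" "length w = word_length G S g"
proof -
  have "\<exists>n. \<exists>w\<in>words S. length w = n \<and> word_value w = g"
    using assms generate_eq_word_value_image by auto
  from LeastI_ex[OF this] show thesis
    using that unfolding word_length_eq_Least by blast
qed

lemma word_length_mult_le:
  assumes S: "S \<subseteq> carrier G" and "g \<in> generate G S" and "h \<in> generate G S"
  shows "word_length G S (g \<otimes> h) \<le> word_length G S g + word_length G S h"
proof -
  obtain u where u: "u \<in> words S" "word_value u = g" "length u = word_length G S g"
    using geodesic_wordE[OF S assms(2)] .
  obtain v where v: "v \<in> words S" "word_value v = h" "length v = word_length G S h"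
    using geodesic_wordE[OF S assms(3)] .
  have "word_value (u @ v) = g \<otimes> h"
    using u v set_word_subset_carrier[OF S] by (simp add: word_value_append)
  with word_length_word_value_le[of "u @ v" S] u v show ?thesis
    by (simp add: append_in_words_iff)
qed

lemma word_length_geodesic_suffix:
  assumes S: "S \<subseteq> carrier G" and words: "u @ v \<in> words S"
    and geodesic: "length (u @ v) = word_length G S (word_value (u @ v))"
  shows "word_length G S (word_value v) = length v"
proof (rule antisym)
  have u: "u \<in> words S" and v: "v \<in> words S"
    using words by (simp_all add: append_in_words_iff)
  then show "word_length G S (word_value v) \<le> length v"
    by (simp add: word_length_word_value_le)
  have "length (u @ v) = word_length G S (word_value u \<otimes> word_value v)"
    using geodesic u v set_word_subset_carrier[OF S]
    by (simp add: word_value_append)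
  also have "\<dots> \<le> word_length G S (word_value u) + word_length G S (word_value v)"
    using u v by (intro word_length_mult_le S) (auto simp: generate_eq_word_value_image[OF S])
  also have "\<dots> \<le> length u + word_length G S (word_value v)"
    using word_length_word_value_le[OF u] by simp
  finally show "length v \<le> word_length G S (word_value v)"
    by simp
qed

lemma word_length_image_downward_closed:
  assumes S: "S \<subseteq> carrier G" and g: "g \<in> generate G S" and n: "n \<le> word_length G S g"
  shows "n \<in> word_length G S ` generate G S"
proof -
  obtain w where w: "w \<in> words S" "word_value w = g" "length w = word_length G S g"
    using geodesic_wordE[OF S g] .
  define u v where "u = take (length w - n) w" and "v = drop (length w - n) w"
  then have uv: "u @ v = w" and length_v: "length v = n"
    using n w(3) by simp_all
  have "word_length G S (word_value v) = n"
    using word_length_geodesic_suffix[OF S, of u v] w unfolding uv length_v by simp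
  moreover have "word_value v \<in> generate G S"
    using w(1) uv append_in_words_iff[of u v S] by (auto simp: generate_eq_word_value_image[OF S])
  ultimately show ?thesis
    by blast
qed

end

theorem theorem3p4:
  fixes G :: "('a, 'b) monoid_scheme"
  assumes "group G"
    and "countable (carrier G)"
    and "has_infinite_diameter_Cayley_graph G"
  shows "weakly_amenable G"
proof -
  interpret group G by fact
  obtain S where S: "S \<subseteq> carrier G" and generates: "generate G S = carrier G"
    and unbounded: "\<And>n. \<exists>g\<in>carrier G. n < word_length G S g"
    using assms(3) unfolding has_infinite_diameter_Cayley_graph_def by blast
  show ?thesis
  proof (rule weakly_amenable_if_bounded_displacement)
    show "\<exists>c. displacement_at_most (word_length G S) g c" if "g \<in> carrier G" for g
      using displacement_at_most_if_subadditive[OF _ that] word_length_mult_le[OF S]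
      unfolding generates by blast
    have "n \<in> word_length G S ` carrier G" for n
      using unbounded[of n] word_length_image_downward_closed[OF S, of _ n] generates
      by (auto dest: less_imp_le)
    then show "word_length G S ` carrier G = UNIV"
      by blast
  qed
qed

end
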